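(* A finite-dimensional Frobenius Lie algebra remains Frobenius under deformation. That is, let $L$ be a finite-dimensional complex Frobenius Lie algebra. Then every formal one-parameter deformation of $L$ is a Frobenius Lie algebra over $\mathbb C((t))$, and every Lie bracket on the vector space $L$ sufficiently close to the original one defines a Frobenius Lie algebra.
   Context: For a finite-dimensional Lie algebra $L$ over a field and $F\in L^*$, let $B_F(x,y)=F([x,y])$. $L$ is Frobenius if there is $F\in L^*$ with $B_F$ non-degenerate. "Deformation" of a complex Lie algebra $L$ with bracket $[\cdot,\cdot]$ is understood as a small change of the Lie product or a change with a formal parameter: a formal one-parameter deformation is a $\mathbb C[[t]]$-bilinear Lie bracket $[x,y]_t=[x,y]+\sum_{k\ge1}t^k\varphi_k(x,y)$ on $L[[t]]$ with $\varphi_k:L\times L\to L$ bilinear, regarded as giving a Lie algebra over $\mathbb C((t))$ after extension of scalars; "sufficiently close" refers to the usual topology on the finite-dimensional space of bilinear maps $L\times L\to L$. *)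

theory Defs
  imports
    "HOL-Analysis.Analysis"
    "HOL-Computational_Algebra.Formal_Laurent_Series"
begin

section \<open>Lie algebras and Frobenius Lie algebras\<close>

definition bilinear_map ::
  "('k::comm_ring_1 \<Rightarrow> 'u::ab_group_add \<Rightarrow> 'u) \<Rightarrow> ('k \<Rightarrow> 'v::ab_group_add \<Rightarrow> 'v) \<Rightarrow>
    ('k \<Rightarrow> 'w::ab_group_add \<Rightarrow> 'w) \<Rightarrow> ('u \<Rightarrow> 'v \<Rightarrow> 'w) \<Rightarrow> bool"
  where "bilinear_map s1 s2 s3 \<beta> \<longleftrightarrow>
    (\<forall>y. module_hom s1 s3 (\<lambda>x. \<beta> x y)) \<and> (\<forall>x. module_hom s2 s3 (\<beta> x))"

text \<open>The scalars form a commutative ring, so that the notion applies both over a field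
  and over a ring of formal power series.\<close>

locale lie_algebra = module s
  for s :: "'k::comm_ring_1 \<Rightarrow> 'v::ab_group_add \<Rightarrow> 'v" +
  fixes bracket :: "'v \<Rightarrow> 'v \<Rightarrow> 'v"
  assumes bilinear_bracket: "bilinear_map s s s bracket"
    and alternating: "bracket x x = 0"
    and jacobi: "bracket x (bracket y z) + bracket y (bracket z x) + bracket z (bracket x y) = 0"

definition nondegenerate_form :: "('v::zero \<Rightarrow> 'v \<Rightarrow> 'k::zero) \<Rightarrow> bool"
  where "nondegenerate_form \<beta> \<longleftrightarrow>
    (\<forall>x. (\<forall>y. \<beta> x y = 0) \<longrightarrow> x = 0) \<and> (\<forall>y. (\<forall>x. \<beta> x y = 0) \<longrightarrow> y = 0)"

definition frobenius_lie_algebra ::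
  "('k::field \<Rightarrow> 'v::ab_group_add \<Rightarrow> 'v) \<Rightarrow> ('v \<Rightarrow> 'v \<Rightarrow> 'v) \<Rightarrow> bool"
  where "frobenius_lie_algebra s bracket \<longleftrightarrow>
    lie_algebra s bracket \<and>
    (\<exists>B. finite_dimensional_vector_space s B) \<and>
    (\<exists>F. Vector_Spaces.linear s (*) F \<and> nondegenerate_form (\<lambda>x y. F (bracket x y)))"


section \<open>Formal deformations\<close>

text \<open>For a vector space \<open>L\<close> with underlying type \<open>'v\<close>, the module \<open>L[[t]]\<close> has
  underlying type \<open>'v fps\<close>, and its localisation \<open>L((t))\<close> has underlying type \<open>'v fls\<close>.\<close>

definition fps_scale ::
  "('k::comm_ring_1 \<Rightarrow> 'v::ab_group_add \<Rightarrow> 'v) \<Rightarrow> 'k fps \<Rightarrow> 'v fps \<Rightarrow> 'v fps"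
  where "fps_scale s f X =
    Abs_fps (\<lambda>n. \<Sum>i=0..n. s (fps_nth f i) (fps_nth X (n - i)))"

text \<open>A deformation is a \<open>k[[t]]\<close>-bilinear Lie bracket on \<open>L[[t]]\<close> with
  \<open>[x,y]\<^sub>t = [x,y] + (\<Sum>k\<ge>1. t\<^sup>k \<phi>\<^sub>k(x,y))\<close> for the constant series \<open>x, y \<in> L\<close>.\<close>

definition formal_deformation ::
  "('k::comm_ring_1 \<Rightarrow> 'v::ab_group_add \<Rightarrow> 'v) \<Rightarrow> ('v \<Rightarrow> 'v \<Rightarrow> 'v) \<Rightarrow>
    ('v fps \<Rightarrow> 'v fps \<Rightarrow> 'v fps) \<Rightarrow> bool"
  where "formal_deformation s bracket bracket_t \<longleftrightarrow>
    lie_algebra (fps_scale s) bracket_t \<and>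
    (\<exists>\<phi>. (\<forall>k\<ge>1. bilinear_map s s s (\<phi> k)) \<and>
         (\<forall>x y. bracket_t (fps_const x) (fps_const y) =
                Abs_fps (\<lambda>k. if k = 0 then bracket x y else \<phi> k x y)))"

text \<open>Extension of scalars along \<open>k[[t]] \<rightarrow> k((t))\<close> of a \<open>k[[t]]\<close>-bilinear operation:
  writing \<open>X = t\<^sup>a X\<^sub>0\<close> and \<open>Y = t\<^sup>b Y\<^sub>0\<close> with power series \<open>X\<^sub>0\<close>, \<open>Y\<^sub>0\<close>, the result is
  \<open>t\<^sup>a\<^sup>+\<^sup>b \<beta>(X\<^sub>0, Y\<^sub>0)\<close>. By bilinearity this does not depend on the choice of \<open>a\<close> and \<open>b\<close>; the
  definition takes them to be the subdegrees.\<close>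

definition fls_extend ::
  "('u::zero fps \<Rightarrow> 'v::zero fps \<Rightarrow> 'w::zero fps) \<Rightarrow> 'u fls \<Rightarrow> 'v fls \<Rightarrow> 'w fls"
  where "fls_extend \<beta> X Y =
    fls_shift (- (fls_subdegree X + fls_subdegree Y))
      (fps_to_fls (\<beta> (fls_base_factor_to_fps X) (fls_base_factor_to_fps Y)))"

definition fls_scale ::
  "('k::comm_ring_1 \<Rightarrow> 'v::ab_group_add \<Rightarrow> 'v) \<Rightarrow> 'k fls \<Rightarrow> 'v fls \<Rightarrow> 'v fls"
  where "fls_scale s = fls_extend (fps_scale s)"


section \<open>The topology on the space of bilinear maps\<close>

text \<open>The topology on the space of bilinear maps \<open>L \<times> L \<rightarrow> L\<close> that comes from identifying it
  with a coordinate space through the structure constants with respect to a finite basis of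
  \<open>L\<close>. It does not depend on the basis.\<close>

definition bilinear_map_topology ::
  "(complex \<Rightarrow> 'v::ab_group_add \<Rightarrow> 'v) \<Rightarrow> 'v set \<Rightarrow> ('v \<Rightarrow> 'v \<Rightarrow> 'v) topology"
  where "bilinear_map_topology s B =
    pullback_topology {\<beta>. bilinear_map s s s \<beta>}
      (\<lambda>\<beta>. \<lambda>(b, c, d) \<in> B \<times> B \<times> B.
        module.representation s B (\<beta> b c) d)
      (product_topology (\<lambda>_. euclidean) (B \<times> B \<times> B))"

end

theory Submission
  imports Defs
begin

text \<open>In both cases the functional \<open>F\<close> of the given algebra keeps working. For a formal
  deformation, extend \<open>F\<close> coefficientwise: if \<open>X \<noteq> 0\<close> has leading coefficient \<open>x\<close>, pick
  \<open>y \<in> L\<close> with \<open>F [x, y] \<noteq> 0\<close>; then \<open>F [X, y]\<^sub>t\<close> has leading coefficient \<open>F [x, y]\<close>. For a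
  nearby bracket, choose \<open>u\<^sub>c\<close> with \<open>F [b, u\<^sub>c] = \<delta>\<^sub>b\<^sub>c\<close> on a basis; the perturbed matrix is still
  strictly diagonally dominant.\<close>

unbundle fps_syntax

section \<open>Alternating forms\<close>

text \<open>An alternating bracket makes the form skew, so its left and right kernels coincide and
  checking the left one suffices.\<close>

lemma nondegenerate_form_linear_bracketI:
  assumes "lie_algebra s br" "Vector_Spaces.linear s (*) F"
    and left: "\<And>x. (\<And>y. F (br x y) = 0) \<Longrightarrow> x = 0"
  shows "nondegenerate_form (\<lambda>x y. F (br x y))"
proof -
  interpret lie_algebra s br by fact
  interpret F: Vector_Spaces.linear s "(*)" F by fact
  have add: "br (x + x') y = br x y + br x' y" "br x (y + y') = br x y + br x y'" for x x' y y'
    using bilinear_bracket by (auto simp: bilinear_map_def module_hom_iff)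
  have skew: "br x y = - br y x" for x y
  proof -
    have "br x y + br y x = br (x + y) (x + y)" by (simp only: add) (simp add: alternating add.commute)
    then show ?thesis by (simp add: alternating eq_neg_iff_add_eq_0)
  qed
  have "F (br x y) = - F (br y x)" for x y
    by (subst skew) (rule F.neg)
  then show ?thesis
    unfolding nondegenerate_form_def using left by (metis neg_equal_0_iff_equal)
qed


section \<open>Perturbation of nondegenerate forms\<close>

text \<open>The map \<open>\<phi>\<close> below packs the values \<beta>(b, y) into the coordinates
  of an endomorphism. Its kernel lies in the right kernel of \<beta>, so it is injective, hence
  surjective in finite dimension; \<open>u c\<close> is a preimage of the basis vector c.\<close>

lemma (in finite_dimensional_vector_space) dual_family_exists:
  assumes \<beta>: "bilinear_map scale scale (*) \<beta>"
    and nd: "\<And>y. (\<And>x. \<beta> x y = 0) \<Longrightarrow> y = 0"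
  obtains u where "\<And>b c. b \<in> Basis \<Longrightarrow> c \<in> Basis \<Longrightarrow> \<beta> b (u c) = of_bool (b = c)"
proof -
  have lin: "module_hom scale (*) (\<lambda>x. \<beta> x y)" "module_hom scale (*) (\<beta> x)" for x y
    using \<beta> by (auto simp: bilinear_map_def)
  define \<phi> where "\<phi> y = (\<Sum>b\<in>Basis. scale (\<beta> b y) b)" for y
  have coord: "\<beta> b y = g b" if "\<phi> y = (\<Sum>b\<in>Basis. scale (g b) b)" "b \<in> Basis" for g y b
  proof -
    have "(\<Sum>b\<in>Basis. scale (\<beta> b y - g b) b) = 0"
      using that by (simp add: \<phi>_def scale_left_diff_distrib sum_subtractf)
    then show ?thesis
      using independentD[OF independent_Basis finite_Basis subset_refl _ that(2)] by fastforce
  qed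
  have lin_\<phi>: "Vector_Spaces.linear scale scale \<phi>"
    unfolding Vector_Spaces.linear_iff using lin(2) vector_space_axioms
    by (auto simp: \<phi>_def module_hom_iff scale_left_distrib sum.distrib scale_sum_right)
  interpret \<phi>: Vector_Spaces.linear scale scale \<phi> by (rule lin_\<phi>)
  have "y = 0" if "\<phi> y = 0" for y
  proof (rule nd)
    fix x
    interpret \<beta>: module_hom scale "(*)" "\<lambda>x. \<beta> x y" by (rule lin(1))
    have "\<beta> x y = \<beta> (\<Sum>b\<in>Basis. scale (representation Basis x b) b) y"
      by (simp add: sum_representation_eq independent_Basis span_Basis finite_Basis)
    also have "\<dots> = 0"
      using coord[of y "\<lambda>_. 0"] that by (simp add: \<beta>.sum \<beta>.scale)
    finally show "\<beta> x y = 0" .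
  qed
  then have "inj \<phi>"
    by (simp add: \<phi>.inj_iff_eq_0)
  then have "surj \<phi>"
    by (rule linear_inj_imp_surj[OF lin_\<phi>])
  then obtain u where u: "\<And>c. \<phi> (u c) = c" by (metis surjD)
  have "\<beta> b (u c) = of_bool (b = c)" if "b \<in> Basis" "c \<in> Basis" for b c
  proof (rule coord[OF _ that(1)])
    have "(\<Sum>b\<in>Basis. scale (of_bool (b = c)) b) = (\<Sum>b\<in>Basis. if b = c then b else 0)"
      by (intro sum.cong) auto
    then show "\<phi> (u c) = (\<Sum>b\<in>Basis. scale (of_bool (b = c)) b)"
      using that finite_Basis by (simp add: u)
  qed
  then show ?thesis by (rule that)
qed

text \<open>A strictly diagonally dominant matrix is injective: look at a coordinate of maximal
  modulus.\<close>

lemma diagonally_dominant_form_injective: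
  fixes s :: "complex \<Rightarrow> 'v::ab_group_add \<Rightarrow> 'v"
  assumes "finite_dimensional_vector_space s B"
    and lin: "\<And>y. module_hom s (*) (\<lambda>x. \<beta> x y)"
    and near: "\<And>b c. b \<in> B \<Longrightarrow> c \<in> B \<Longrightarrow>
      cmod (\<beta> b (u c) - of_bool (b = c)) < 1 / (real (card B) + 1)"
    and zero: "\<And>y. \<beta> x y = 0"
  shows "x = 0"
proof -
  interpret finite_dimensional_vector_space s B by fact
  define a where "a = representation B x"
  have x: "x = (\<Sum>b\<in>B. s (a b) b)"
    unfolding a_def
    by (rule sum_representation_eq[symmetric])
      (auto simp: independent_Basis span_Basis finite_Basis)
  show ?thesis
  proof (cases "B = {}")
    case True
    then show ?thesis using x by simp
  next
    case False
    have "\<exists>m\<in>B. \<forall>b\<in>B. cmod (a b) \<le> cmod (a m)"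
    proof -
      have "Max ((\<lambda>b. cmod (a b)) ` B) \<in> (\<lambda>b. cmod (a b)) ` B"
        using False finite_Basis by (intro Max_in) auto
      then obtain m where "m \<in> B" "Max ((\<lambda>b. cmod (a b)) ` B) = cmod (a m)" by auto
      then show ?thesis
        using finite_Basis by (metis Max_ge finite_imageI imageI)
    qed
    then obtain m where m: "m \<in> B" "\<And>b. b \<in> B \<Longrightarrow> cmod (a b) \<le> cmod (a m)" by blast
    interpret \<beta>: module_hom s "(*)" "\<lambda>x. \<beta> x (u m)" by (rule lin)
    \<comment> \<open>Pairing with \<open>u m\<close> selects the matrix column that belongs to the
      largest coordinate.\<close>
    have "0 = (\<Sum>b\<in>B. a b * \<beta> b (u m))"
      using zero[of "u m"] unfolding x by (simp add: \<beta>.sum \<beta>.scale)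
    moreover have "(\<Sum>b\<in>B. a b * of_bool (b = m)) = (\<Sum>b\<in>B. if b = m then a b else 0)"
      by (intro sum.cong) auto
    ultimately have "- a m = (\<Sum>b\<in>B. a b * (\<beta> b (u m) - of_bool (b = m)))"
      using m(1) finite_Basis by (simp add: right_diff_distrib sum_subtractf)
    then have "cmod (a m) = cmod (\<Sum>b\<in>B. a b * (\<beta> b (u m) - of_bool (b = m)))"
      by (metis norm_minus_cancel)
    \<comment> \<open>There are \<open>card B\<close> terms with tolerance 1 / (card B + 1) each, so
      the total factor stays strictly below 1.\<close>
    also have "\<dots> \<le> (\<Sum>b\<in>B. cmod (a m) * (1 / (real (card B) + 1)))"
    proof (rule sum_norm_le)
      fix b assume "b \<in> B"
      then show "cmod (a b * (\<beta> b (u m) - of_bool (b = m)))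
          \<le> cmod (a m) * (1 / (real (card B) + 1))"
        unfolding norm_mult using m near[of b m]
        by (intro mult_mono) (auto intro: less_imp_le)
    qed
    also have "\<dots> = cmod (a m) * (real (card B) / (real (card B) + 1))"
      by simp
    finally have "cmod (a m) * (1 - real (card B) / (real (card B) + 1)) \<le> 0"
      by (simp add: right_diff_distrib)
    moreover have "1 - real (card B) / (real (card B) + 1) > 0" by simp
    ultimately have "cmod (a m) = 0"
      by (metis mult_le_0_iff norm_ge_zero not_le order_antisym)
    then have "a b = 0" if "b \<in> B" for b using m(2)[OF that] by simp
    then show ?thesis using x by simp
  qed
qed

section \<open>Openness of the Frobenius condition among Lie brackets\<close>

lemma frobenius_lie_algebra_open:
  fixes s :: "complex \<Rightarrow> 'v::ab_group_add \<Rightarrow> 'v"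
  assumes frob: "frobenius_lie_algebra s br" and fd: "finite_dimensional_vector_space s B"
  shows "\<exists>U. openin (bilinear_map_topology s B) U \<and> br \<in> U \<and>
    (\<forall>br' \<in> U. lie_algebra s br' \<longrightarrow> frobenius_lie_algebra s br')"
proof -
  interpret finite_dimensional_vector_space s B by (rule fd)
  interpret lie_algebra s br using frob by (simp add: frobenius_lie_algebra_def)
  obtain F where F: "Vector_Spaces.linear s (*) F"
    and nd: "nondegenerate_form (\<lambda>x y. F (br x y))"
    using frob by (auto simp: frobenius_lie_algebra_def)
  interpret F: Vector_Spaces.linear s "(*)" F by (rule F)
  have F_bilinear: "bilinear_map s s (*) (\<lambda>x y. F (\<beta> x y))" if "bilinear_map s s s \<beta>" for \<beta>
    using that F.module_hom_axioms by (auto simp: bilinear_map_def module_hom_iff)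
  obtain u where u: "\<And>b c. b \<in> B \<Longrightarrow> c \<in> B \<Longrightarrow> F (br b (u c)) = of_bool (b = c)"
    using dual_family_exists[OF F_bilinear[OF bilinear_bracket]] nd
    unfolding nondegenerate_form_def by metis
  define \<epsilon> where "\<epsilon> = 1 / (real (card B) + 1)"
  define coord where "coord \<beta> = (\<lambda>(b, c, d) \<in> B \<times> B \<times> B. representation B (\<beta> b c) d)"
    for \<beta> :: "'v \<Rightarrow> 'v \<Rightarrow> 'v"
  let ?P = "product_topology (\<lambda>_. euclidean :: complex topology) (B \<times> B \<times> B)"
  \<comment> \<open>The matrix entry F(\<beta>(b, u c)) as a linear function of the structure
    constants: \<open>u c\<close> is expanded in the basis, then each \<beta>(b, d).\<close>
  define h where "h b c p =
    (\<Sum>d\<in>B. \<Sum>e\<in>B. representation B (u c) d * (p (b, d, e) * F e))"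
    for b c and p :: "'v \<times> 'v \<times> 'v \<Rightarrow> complex"
  have h_coord: "h b c (coord \<beta>) = F (\<beta> b (u c))"
    if "bilinear_map s s s \<beta>" "b \<in> B" for b c \<beta>
  proof -
    interpret \<beta>: module_hom s s "\<beta> b" using that by (simp add: bilinear_map_def)
    have rep: "(\<Sum>b\<in>B. s (representation B v b) b) = v" for v
      by (rule sum_representation_eq) (auto simp: independent_Basis span_Basis finite_Basis)
    have "F (\<beta> b (u c)) = F (\<beta> b (\<Sum>d\<in>B. s (representation B (u c) d) d))"
      by (simp only: rep)
    also have "\<dots> = (\<Sum>d\<in>B. representation B (u c) d * F (\<beta> b d))"
      by (simp add: \<beta>.sum \<beta>.scale F.sum F.scale)
    also have "\<dots> = (\<Sum>d\<in>B. representation B (u c) d *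
        F (\<Sum>e\<in>B. s (representation B (\<beta> b d) e) e))"
      by (simp only: rep)
    also have "\<dots> = h b c (coord \<beta>)"
      using that(2) by (simp add: h_def coord_def F.sum F.scale sum_distrib_left)
    finally show ?thesis ..
  qed
  \<comment> \<open>The factor \<open>topspace ?P\<close> matters for empty \<open>B\<close>, where
    the intersection over \<open>B \<times> B\<close> is \<open>UNIV\<close>, which is not
    open.\<close>
  define W where "W = topspace ?P \<inter>
    (\<Inter>(b, c) \<in> B \<times> B. {p \<in> topspace ?P. h b c p \<in> ball (of_bool (b = c)) \<epsilon>})"
  have cont: "continuous_map ?P euclidean (h b c)" if "b \<in> B" for b c
  proof -
    have "continuous_map ?P euclidean (\<lambda>p. representation B (u c) d * (p (b, d, e) * F e))"
      if "d \<in> B" "e \<in> B" for d e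
    proof -
      have "continuous_map ?P euclidean (\<lambda>p. p (b, d, e))"
        using that \<open>b \<in> B\<close> by (intro continuous_map_product_projection) auto
      moreover have "continuous_map euclidean euclidean
          (\<lambda>z. representation B (u c) d * (z * F e))"
        by (auto intro!: continuous_intros)
      ultimately show ?thesis
        using continuous_map_compose[of ?P euclidean "\<lambda>p. p (b, d, e)" euclidean
            "\<lambda>z. representation B (u c) d * (z * F e)"] by (simp add: o_def)
    qed
    then show ?thesis
      unfolding h_def by (intro continuous_map_sum finite_Basis) auto
  qed
  have "openin ?P {p \<in> topspace ?P. h b c p \<in> ball (of_bool (b = c)) \<epsilon>}"
    if "b \<in> B" for b c
    by (rule openin_continuous_map_preimage[OF cont[OF that]]) auto
  then have "openin ?P W"
    unfolding W_def by (intro openin_Int_Inter openin_topspace) (auto simp: finite_Basis)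
  have "coord \<beta> \<in> topspace ?P" for \<beta>
    by (auto simp: coord_def)
  then have coord_W: "coord \<beta> \<in> W \<longleftrightarrow>
      (\<forall>b\<in>B. \<forall>c\<in>B. cmod (F (\<beta> b (u c)) - of_bool (b = c)) < \<epsilon>)"
    if "bilinear_map s s s \<beta>" for \<beta>
    using h_coord[OF that] by (auto simp: W_def dist_norm norm_minus_commute)
  \<comment> \<open>\<open>coord\<close> is the map whose pullback defines the topology, so this set
    is open by definition once \<open>W\<close> is.\<close>
  let ?U = "coord -` W \<inter> {\<beta>. bilinear_map s s s \<beta>}"
  have "openin (bilinear_map_topology s B) ?U"
    unfolding bilinear_map_topology_def openin_pullback_topology coord_def[symmetric]
    using \<open>openin ?P W\<close> by blast
  \<comment> \<open>For \<open>br\<close> itself the matrix is exactly the identity.\<close>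
  moreover have "br \<in> ?U"
    using bilinear_bracket u by (auto simp: coord_W \<epsilon>_def intro!: divide_pos_pos)
  moreover have "frobenius_lie_algebra s br'" if "br' \<in> ?U" "lie_algebra s br'" for br'
  proof -
    have bil: "bilinear_map s s s br'" using that(1) by simp
    have "nondegenerate_form (\<lambda>x y. F (br' x y))"
    proof (rule nondegenerate_form_linear_bracketI[OF that(2) F])
      fix x assume "\<And>y. F (br' x y) = 0"
      then show "x = 0"
        using that(1) F_bilinear[OF bil]
        by (intro diagonally_dominant_form_injective[OF fd, of "\<lambda>x y. F (br' x y)" u])
          (auto simp: coord_W[OF bil] \<epsilon>_def bilinear_map_def)
    qed
    then show ?thesis
      unfolding frobenius_lie_algebra_def using that(2) fd F by blast
  qed
  ultimately show ?thesis by blast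
qed


section \<open>Extending operations on power series to Laurent series\<close>

text \<open>Multiplication by t, written as an index shift because vector coefficients carry no ring
  structure.\<close>

definition fps_up :: "'a::zero fps \<Rightarrow> 'a fps"
  where "fps_up x = Abs_fps (\<lambda>n. case n of 0 \<Rightarrow> 0 | Suc k \<Rightarrow> fps_nth x k)"

lemma fps_nth_fps_up [simp]:
  "fps_nth (fps_up x) 0 = 0" "fps_nth (fps_up x) (Suc n) = fps_nth x n"
  by (simp_all add: fps_up_def)

lemma fps_const_plus_fps_up: "x = fps_const (fps_nth x 0) + fps_up (fps_shift 1 x)"
  for x :: "'a::monoid_add fps"
proof (rule fps_ext)
  show "fps_nth x n = fps_nth (fps_const (fps_nth x 0) + fps_up (fps_shift 1 x)) n" for n
    by (cases n) auto
qed

text \<open>The series t^a x. \<open>fls_shift\<close> lowers exponents, hence the sign. The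
  constant term of \<open>x\<close> may vanish, so one Laurent series has many such forms.\<close>

abbreviation laurent :: "int \<Rightarrow> 'a::zero fps \<Rightarrow> 'a fls"
  where "laurent a x \<equiv> fls_shift (- a) (fps_to_fls x)"

lemma laurent_eq_iff: "laurent a x = laurent a y \<longleftrightarrow> x = y"
  using fps_to_fls_eq_imp_fps_eq by (auto simp: fls_shift_eq_iff)

lemma laurent_add: "laurent a (x + y) = laurent a x + laurent a y"
  for x y :: "'a::monoid_add fps"
  by (intro fls_eqI) simp

text \<open>Factors t move freely between exponent and power series, which lets different forms of
  one Laurent series be compared.\<close>

lemma laurent_fps_up_funpow: "laurent a ((fps_up ^^ n) x) = laurent (a + int n) x"
proof (induction n arbitrary: a)
  case (Suc n)
  have "laurent a (fps_up y) = laurent (a + 1) y" for y :: "'a fps"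
  proof (rule fls_eqI)
    fix k
    show "laurent a (fps_up y) $$ k = laurent (a + 1) y $$ k"
    proof (cases "k - a \<le> 0")
      case False
      then have "nat (k - a) = Suc (nat (k - (a + 1)))" by simp
      then show ?thesis using False by (simp add: algebra_simps)
    qed auto
  qed
  then show ?case using Suc[of "a + 1"] by (simp add: algebra_simps)
qed simp

lemma laurent_of_le_subdegree:
  assumes "a \<le> fls_subdegree X"
  obtains x where "X = laurent a x"
proof
  show "X = laurent a (fls_regpart (fls_shift a X))"
    using assms by (intro fls_eqI) (auto simp: fls_eq0_below_subdegree)
qed

lemma laurent_cases:
  obtains a x where "X = laurent a x"
  using laurent_of_le_subdegree[of "fls_subdegree X" X] by blast

text \<open>Over a common exponent, sums of Laurent series become sums of power series.\<close>

lemma laurent_common2: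
  obtains a x y where "X = laurent a x" "Y = laurent a y"
  using laurent_of_le_subdegree[of "min (fls_subdegree X) (fls_subdegree Y)" X]
    laurent_of_le_subdegree[of "min (fls_subdegree X) (fls_subdegree Y)" Y]
  by (metis min.cobounded1 min.cobounded2)

lemma laurent_common3:
  obtains a x y z where "X = laurent a x" "Y = laurent a y" "Z = laurent a z"
proof -
  let ?m = "min (fls_subdegree X) (min (fls_subdegree Y) (fls_subdegree Z))"
  obtain x y z where "X = laurent ?m x" "Y = laurent ?m y" "Z = laurent ?m z"
    by (metis laurent_of_le_subdegree min.cobounded1 min.cobounded2 min.coboundedI2)
  then show ?thesis by (rule that)
qed

text \<open>These laws carry the extension from power series to Laurent series. The three
  coefficient types may differ, so that scalar multiplication, brackets and products of scalars are
  all instances.\<close>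

locale fps_biadditive =
  fixes \<beta> :: "'u::ab_group_add fps \<Rightarrow> 'v::ab_group_add fps \<Rightarrow> 'w::ab_group_add fps"
  assumes add_left: "\<beta> (x + x') y = \<beta> x y + \<beta> x' y"
    and add_right: "\<beta> x (y + y') = \<beta> x y + \<beta> x y'"
    and up_left: "\<beta> (fps_up x) y = fps_up (\<beta> x y)"
    and up_right: "\<beta> x (fps_up y) = fps_up (\<beta> x y)"
begin

lemma zero_left [simp]: "\<beta> 0 y = 0"
  using add_left[of 0 0 y] by simp

lemma zero_right [simp]: "\<beta> x 0 = 0"
  using add_right[of x 0 0] by simp

lemma funpow_up: "\<beta> ((fps_up ^^ m) x) ((fps_up ^^ n) y) = (fps_up ^^ (m + n)) (\<beta> x y)"
proof (induction m)
  case 0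
  show ?case by (induction n) (simp_all add: up_right)
qed (simp add: up_left)

text \<open>\<open>fls_extend\<close> is defined through subdegrees. Any other form of a nonzero
  argument differs by powers of t, which \<beta> lets out of both arguments, so every choice of
  exponents gives the same value. Identities for Laurent series are reduced to power series by this
  formula.\<close>

lemma fls_extend_laurent:
  "fls_extend \<beta> (laurent a x) (laurent b y) = laurent (a + b) (\<beta> x y)"
\<comment> \<open>The subdegree of 0 is a default value unrelated to the chosen exponent, so this
  case stands apart.\<close>
proof (cases "x = 0 \<or> y = 0")
  case True
  then show ?thesis by (auto simp: fls_extend_def)
next
  case False
  have base: "\<exists>n. fls_subdegree (laurent c z) = c + int n \<and>
      z = (fps_up ^^ n) (fls_base_factor_to_fps (laurent c z))" if "z \<noteq> 0"
    for c and z :: "'x::zero fps"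
  proof -
    let ?Z = "laurent c z"
    have "?Z \<noteq> 0" using that by (simp add: fls_shift_eq0_iff)
    then have "c \<le> fls_subdegree ?Z"
      by (intro fls_subdegree_geI) auto
    then obtain n where n: "fls_subdegree ?Z = c + int n"
      using zle_iff_zadd by blast
    have "?Z = laurent (fls_subdegree ?Z) (fls_base_factor_to_fps ?Z)"
      by (rule fls_conv_base_factor_to_fps_shift_subdegree)
    also have "\<dots> = laurent c ((fps_up ^^ n) (fls_base_factor_to_fps ?Z))"
      by (simp only: n laurent_fps_up_funpow)
    finally have "z = (fps_up ^^ n) (fls_base_factor_to_fps ?Z)"
      by (simp only: laurent_eq_iff)
    with n show ?thesis by blast
  qed
  obtain m where m: "fls_subdegree (laurent a x) = a + int m"
      "x = (fps_up ^^ m) (fls_base_factor_to_fps (laurent a x))"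
    using base[of x a] False by blast
  obtain n where n: "fls_subdegree (laurent b y) = b + int n"
      "y = (fps_up ^^ n) (fls_base_factor_to_fps (laurent b y))"
    using base[of y b] False by blast
  define x' where "x' = fls_base_factor_to_fps (laurent a x)"
  define y' where "y' = fls_base_factor_to_fps (laurent b y)"
  have "\<beta> x y = (fps_up ^^ (m + n)) (\<beta> x' y')"
    using m(2) n(2) funpow_up unfolding x'_def[symmetric] y'_def[symmetric] by metis
  then have "laurent (a + b) (\<beta> x y) = laurent (a + int m + (b + int n)) (\<beta> x' y')"
    by (simp only: laurent_fps_up_funpow) (simp add: algebra_simps)
  then show ?thesis
    unfolding fls_extend_def m(1) n(1) x'_def[symmetric] y'_def[symmetric] by simp
qed

lemma fls_extend_add_left: "fls_extend \<beta> (X + X') Y = fls_extend \<beta> X Y + fls_extend \<beta> X' Y"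
proof -
  obtain a x x' where "X = laurent a x" "X' = laurent a x'" by (rule laurent_common2)
  moreover obtain b y where "Y = laurent b y" by (rule laurent_cases)
  ultimately show ?thesis
    by (simp only: laurent_add[symmetric] fls_extend_laurent add_left)
qed

lemma fls_extend_add_right: "fls_extend \<beta> X (Y + Y') = fls_extend \<beta> X Y + fls_extend \<beta> X Y'"
proof -
  obtain a y y' where "Y = laurent a y" "Y' = laurent a y'" by (rule laurent_common2)
  moreover obtain b x where "X = laurent b x" by (rule laurent_cases)
  ultimately show ?thesis
    by (simp only: laurent_add[symmetric] fls_extend_laurent add_right)
qed

end

section \<open>Scalar multiplication on L((t)) and its dimension\<close>

lemma fps_nth_fps_scale:
  "fps_nth (fps_scale s f x) n = (\<Sum>i=0..n. s (fps_nth f i) (fps_nth x (n - i)))"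
  by (simp add: fps_scale_def)

lemma fps_biadditive_fps_scale:
  assumes "module s"
  shows "fps_biadditive (fps_scale s)"
proof -
  interpret module s by fact
  show ?thesis
  proof
    show "fps_scale s (f + g) x = fps_scale s f x + fps_scale s g x" for f g x
      by (rule fps_ext) (simp add: fps_nth_fps_scale scale_left_distrib sum.distrib)
    show "fps_scale s f (x + y) = fps_scale s f x + fps_scale s f y" for f x y
      by (rule fps_ext) (simp add: fps_nth_fps_scale scale_right_distrib sum.distrib)
    show "fps_scale s (fps_up f) x = fps_up (fps_scale s f x)" for f x
    proof (rule fps_ext)
      show "fps_nth (fps_scale s (fps_up f) x) n = fps_nth (fps_up (fps_scale s f x)) n" for n
        \<comment> \<open>The term i = 0 of the convolution vanishes, and the rest is the
          convolution one degree lower.\<close>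
        by (cases n) (simp_all add: fps_nth_fps_scale sum.atLeast0_atMost_Suc_shift
            del: sum.cl_ivl_Suc)
    qed
    show "fps_scale s f (fps_up x) = fps_up (fps_scale s f x)" for f x
    proof (rule fps_ext)
      show "fps_nth (fps_scale s f (fps_up x)) n = fps_nth (fps_up (fps_scale s f x)) n" for n
        \<comment> \<open>Here it is the last term that vanishes, since it meets the zero constant
          term of \<open>fps_up x\<close>.\<close>
        by (cases n) (auto simp add: fps_nth_fps_scale Suc_diff_le intro!: sum.cong)
    qed
  qed
qed

lemma fps_scale_mult: "fps_scale (*) = (*)"
  by (intro ext fps_ext) (simp add: fps_nth_fps_scale fps_mult_nth)

text \<open>Multiplication of Laurent series is by definition \<open>fls_extend\<close> of
  multiplication of power series, and the latter is \<open>fps_scale\<close> for the scalars acting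
  on themselves.\<close>

lemma laurent_mult: "laurent a f * laurent b g = laurent (a + b) (f * g)"
  for f g :: "'a::comm_ring_1 fps"
proof -
  have "module ((*) :: 'a \<Rightarrow> 'a \<Rightarrow> 'a)" by unfold_locales (auto simp: algebra_simps)
  then interpret fps_biadditive "(*) :: 'a fps \<Rightarrow> 'a fps \<Rightarrow> 'a fps"
    using fps_biadditive_fps_scale[of "(*)"] by (simp add: fps_scale_mult)
  have "fls_extend (*) X Y = X * Y" for X Y :: "'a fls"
    by (simp add: fls_extend_def fls_times_def)
  then show ?thesis using fls_extend_laurent[of a f b g] by simp
qed

lemma fls_scale_laurent:
  assumes "module s"
  shows "fls_scale s (laurent a f) (laurent b x) = laurent (a + b) (fps_scale s f x)"
proof -
  interpret fps_biadditive "fps_scale s" by (rule fps_biadditive_fps_scale[OF assms])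
  show ?thesis unfolding fls_scale_def by (rule fls_extend_laurent)
qed

text \<open>Pulling out powers of t reduces the axioms to power series. The module property of
  \<open>fps_scale s\<close> enters as a hypothesis because a formal deformation carries it.\<close>

lemma module_fls_scale:
  assumes s: "module s" and t: "module (fps_scale s)"
  shows "module (fls_scale s)"
proof -
  interpret t: module "fps_scale s" by (rule t)
  interpret fps_biadditive "fps_scale s" by (rule fps_biadditive_fps_scale[OF s])
  show ?thesis
  proof
    fix f g X Y
    show "fls_scale s f (X + Y) = fls_scale s f X + fls_scale s f Y"
      unfolding fls_scale_def by (rule fls_extend_add_right)
    show "fls_scale s (f + g) X = fls_scale s f X + fls_scale s g X"
      unfolding fls_scale_def by (rule fls_extend_add_left)
    obtain a p where f: "f = laurent a p" by (rule laurent_cases)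
    obtain b q where g: "g = laurent b q" by (rule laurent_cases)
    obtain c x where X: "X = laurent c x" by (rule laurent_cases)
    show "fls_scale s f (fls_scale s g X) = fls_scale s (f * g) X"
      by (simp only: f g X laurent_mult fls_scale_laurent[OF s] t.scale_scale add.assoc)
    have "fls_scale s (laurent 0 1) X = X"
      by (simp only: X fls_scale_laurent[OF s] t.scale_one add_0_left)
    then show "fls_scale s 1 X = X" by simp
  qed
qed

text \<open>With a constant second factor only one term of the convolution survives.\<close>

lemma fls_scale_fls_const_nth:
  assumes "module s"
  shows "fls_scale s f (fls_const x) $$ n = s (f $$ n) x"
proof -
  interpret module s by fact
  obtain a p where f: "f = laurent a p" by (rule laurent_cases)
  have "fps_nth (fps_scale s p (fps_const x)) k = s (fps_nth p k) x" for k
  proof -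
    have "fps_nth (fps_scale s p (fps_const x)) k
        = (\<Sum>i=0..k. if i = k then s (fps_nth p i) x else 0)"
      unfolding fps_nth_fps_scale by (intro sum.cong) auto
    then show ?thesis by simp
  qed
  moreover have "fls_scale s f (fls_const x) = laurent a (fps_scale s p (fps_const x))"
    using fls_scale_laurent[OF assms, of a p 0 "fps_const x"] by (simp add: f)
  ultimately show ?thesis by (simp add: f)
qed

text \<open>The n-th coefficient of a combination of constant series is the combination of
  \<open>B\<close> with the n-th coefficients of the scalars, so independence and spanning can be
  checked degree by degree.\<close>

lemma finite_dimensional_fls_scale:
  assumes fd: "finite_dimensional_vector_space s B" and m: "module (fls_scale s)"
  shows "finite_dimensional_vector_space (fls_scale s) (fls_const ` B)"
proof -
  interpret finite_dimensional_vector_space s B by (rule fd)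
  interpret L: vector_space "fls_scale s" using m by (simp add: module_iff_vector_space)
  have inj: "inj_on fls_const B"
    by (rule inj_onI) (metis fls_const_nth)
  have nth: "(\<Sum>v\<in>fls_const ` B. fls_scale s (g v) v) $$ n = (\<Sum>b\<in>B. s (g (fls_const b) $$ n) b)"
    for g n
    by (simp add: sum.reindex[OF inj] fls_nth_sum fls_scale_fls_const_nth[OF module_axioms])
  show ?thesis
  proof
    show "finite (fls_const ` B)" using finite_Basis by simp
    show "L.independent (fls_const ` B)"
    proof (rule L.independent_if_scalars_zero)
      show "finite (fls_const ` B)" using finite_Basis by simp
      fix g v assume z: "(\<Sum>v\<in>fls_const ` B. fls_scale s (g v) v) = 0" and "v \<in> fls_const ` B"
      then obtain b where b: "b \<in> B" "v = fls_const b" by blast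
      have "g (fls_const b) $$ n = 0" for n
        using independentD[OF independent_Basis finite_Basis subset_refl _ b(1),
            of "\<lambda>b. g (fls_const b) $$ n"] nth[of g n] z by simp
      then show "g v = 0" using b by (intro fls_eqI) simp
    qed
    have "X \<in> L.span (fls_const ` B)" for X
    proof -
      \<comment> \<open>The b-coordinates of all coefficients of \<open>X\<close> form a Laurent
        series, as they vanish below the subdegree of \<open>X\<close>.\<close>
      define g where "g b = Abs_fls (\<lambda>n. representation B (X $$ n) b)" for b
      have g: "g b $$ n = representation B (X $$ n) b" for b n
        unfolding g_def
        by (rule nth_Abs_fls_lower_bound[of "fls_subdegree X"])
          (simp add: representation_zero)
      have "X = (\<Sum>v\<in>fls_const ` B. fls_scale s (g (v $$ 0)) v)"
        by (rule fls_eqI)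
          (simp add: nth g sum_representation_eq independent_Basis span_Basis finite_Basis)
      then show ?thesis
        by (metis (no_types, lifting) L.span_base L.span_scale L.span_sum)
    qed
    then show "L.span (fls_const ` B) = UNIV" by auto
  qed
qed


section \<open>Formal deformations\<close>

text \<open>Multiplication by t is scaling by the series \<open>fps_up 1\<close>, so linearity over
  power series gives compatibility with \<open>fps_up\<close>.\<close>

lemma fps_biadditive_bilinear_map:
  assumes s: "module s" and t: "bilinear_map (fps_scale s) (fps_scale s) (fps_scale s) \<beta>"
  shows "fps_biadditive \<beta>"
proof -
  interpret S: fps_biadditive "fps_scale s" by (rule fps_biadditive_fps_scale[OF s])
  have hom: "module_hom (fps_scale s) (fps_scale s) (\<lambda>x. \<beta> x y)"
    "module_hom (fps_scale s) (fps_scale s) (\<beta> x)" for x y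
    using t by (auto simp: bilinear_map_def)
  interpret t: module "fps_scale s" using hom(1) by (simp add: module_hom_iff)
  have up: "fps_up x = fps_scale s (fps_up 1) x" for x
    by (simp add: S.up_left)
  show ?thesis
  proof
    show "\<beta> (fps_up x) y = fps_up (\<beta> x y)" "\<beta> x (fps_up y) = fps_up (\<beta> x y)" for x y
      using hom by (simp_all add: up module_hom_iff)
  qed (use hom in \<open>simp_all add: module_hom_iff\<close>)
qed

lemma lie_algebra_fls_extend:
  fixes s :: "'k::comm_ring_1 \<Rightarrow> 'v::ab_group_add \<Rightarrow> 'v"
  assumes s: "module s" and t: "lie_algebra (fps_scale s) br"
  shows "lie_algebra (fls_scale s) (fls_extend br)"
proof -
  interpret t: lie_algebra "fps_scale s" br by (rule t)
  interpret \<beta>: fps_biadditive br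
    by (rule fps_biadditive_bilinear_map[OF s t.bilinear_bracket])
  have scale: "br (fps_scale s f x) y = fps_scale s f (br x y)"
    "br x (fps_scale s f y) = fps_scale s f (br x y)" for f x y
    using t.bilinear_bracket by (simp_all add: bilinear_map_def module_hom_iff)
  have m: "module (fls_scale s)" by (rule module_fls_scale[OF s t.module_axioms])
  interpret L: module "fls_scale s" by (rule m)
  show ?thesis
  proof
    have "fls_extend br (fls_scale s f X) Y = fls_scale s f (fls_extend br X Y)"
      "fls_extend br X (fls_scale s f Y) = fls_scale s f (fls_extend br X Y)" for f X Y
    proof -
      obtain c p where f: "f = laurent c p" by (rule laurent_cases)
      obtain a x where X: "X = laurent a x" by (rule laurent_cases)
      obtain b y where Y: "Y = laurent b y" by (rule laurent_cases)
      show "fls_extend br (fls_scale s f X) Y = fls_scale s f (fls_extend br X Y)"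
        "fls_extend br X (fls_scale s f Y) = fls_scale s f (fls_extend br X Y)"
        by (simp_all only: f X Y fls_scale_laurent[OF s] \<beta>.fls_extend_laurent scale ac_simps)
    qed
    then show "bilinear_map (fls_scale s) (fls_scale s) (fls_scale s) (fls_extend br)"
      by (simp add: bilinear_map_def module_hom_iff m
          \<beta>.fls_extend_add_left \<beta>.fls_extend_add_right)
    fix X Y Z :: "'v fls"
    \<comment> \<open>A common exponent a gives all three Jacobi terms the exponent a + (a + a), so
      that they add up as power series.\<close>
    obtain a x y z where XYZ: "X = laurent a x" "Y = laurent a y" "Z = laurent a z"
      by (rule laurent_common3)
    show "fls_extend br X X = 0"
      by (simp only: XYZ \<beta>.fls_extend_laurent t.alternating) simp
    show "fls_extend br X (fls_extend br Y Z) + fls_extend br Y (fls_extend br Z X)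
        + fls_extend br Z (fls_extend br X Y) = 0"
      by (simp only: XYZ \<beta>.fls_extend_laurent laurent_add[symmetric] t.jacobi) simp
  qed
qed

section \<open>Coefficientwise extension of a functional\<close>

definition fls_map :: "('a::zero \<Rightarrow> 'b::zero) \<Rightarrow> 'a fls \<Rightarrow> 'b fls"
  where "fls_map F X = Abs_fls (\<lambda>n. F (X $$ n))"

text \<open>Without \<open>F 0 = 0\<close>, the coefficients need not vanish below any bound.\<close>

lemma fls_map_nth: "F 0 = 0 \<Longrightarrow> fls_map F X $$ n = F (X $$ n)"
  unfolding fls_map_def by (rule nth_Abs_fls_lower_bound[of "fls_subdegree X"]) simp

lemma linear_fls_map:
  assumes F: "Vector_Spaces.linear s (*) F" and m: "module (fls_scale s)"
  shows "Vector_Spaces.linear (fls_scale s) (*) (fls_map F)"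
proof -
  interpret F: Vector_Spaces.linear s "(*)" F by (rule F)
  have s: "module s"
    using F.module_hom_axioms by (simp add: module_hom_iff)
  have scale: "fls_map F (fls_scale s f X) = f * fls_map F X" for f X
  proof -
    \<comment> \<open>The power series version of \<open>fls_map F\<close>; it turns the convolution
      into a product because \<open>F\<close> is linear.\<close>
    define F' where "F' x = Abs_fps (\<lambda>n. F (fps_nth x n))" for x
    have F': "fls_map F (laurent a x) = laurent a (F' x)" for a x
      by (rule fls_eqI) (simp add: fls_map_nth F'_def)
    have "F' (fps_scale s p x) = p * F' x" for p x
      by (rule fps_ext) (simp add: F'_def fps_nth_fps_scale fps_mult_nth F.sum F.scale)
    moreover obtain a p where "f = laurent a p" by (rule laurent_cases)
    moreover obtain b x where "X = laurent b x" by (rule laurent_cases)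
    ultimately show ?thesis
      by (simp only: F' fls_scale_laurent[OF s] laurent_mult)
  qed
  have "vector_space ((*) :: 'a fls \<Rightarrow> _)" by unfold_locales (auto simp: algebra_simps)
  moreover have "fls_map F (X + Y) = fls_map F X + fls_map F Y" for X Y
    by (rule fls_eqI) (simp add: fls_map_nth F.add)
  ultimately show ?thesis
    using m scale by (simp add: Vector_Spaces.linear_iff module_iff_vector_space)
qed

text \<open>Modulo t both arguments may be replaced by their constant terms, and on constants the
  deformation starts with \<open>br\<close>.\<close>

lemma formal_deformation_nth_0:
  assumes s: "module s" and d: "formal_deformation s br br_t"
  shows "fps_nth (br_t x y) 0 = br (fps_nth x 0) (fps_nth y 0)"
proof -
  interpret t: lie_algebra "fps_scale s" br_t
    using d by (simp add: formal_deformation_def)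
  interpret \<beta>: fps_biadditive br_t
    by (rule fps_biadditive_bilinear_map[OF s t.bilinear_bracket])
  have "fps_nth (br_t (fps_const v) (fps_const w)) 0 = br v w" for v w
    using d by (auto simp: formal_deformation_def)
  moreover have "br_t x y = br_t (fps_const (fps_nth x 0) + fps_up (fps_shift 1 x))
      (fps_const (fps_nth y 0) + fps_up (fps_shift 1 y))"
    by (simp only: fps_const_plus_fps_up[symmetric])
  ultimately show ?thesis
    by (simp add: \<beta>.add_left \<beta>.add_right \<beta>.up_left \<beta>.up_right del: fps_shift_add)
qed

text \<open>The lowest coefficient of the pairing involves only the original bracket, so higher
  order terms of the deformation cannot produce a kernel.\<close>

lemma frobenius_formal_deformation:
  assumes frob: "frobenius_lie_algebra s br" and d: "formal_deformation s br br_t"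
  shows "frobenius_lie_algebra (fls_scale s) (fls_extend br_t)"
proof -
  interpret lie_algebra s br using frob by (simp add: frobenius_lie_algebra_def)
  obtain B F where fd: "finite_dimensional_vector_space s B"
    and F: "Vector_Spaces.linear s (*) F"
    and nd: "nondegenerate_form (\<lambda>x y. F (br x y))"
    using frob by (auto simp: frobenius_lie_algebra_def)
  interpret F: Vector_Spaces.linear s "(*)" F by (rule F)
  interpret t: lie_algebra "fps_scale s" br_t
    using d by (simp add: formal_deformation_def)
  interpret \<beta>: fps_biadditive br_t
    by (rule fps_biadditive_bilinear_map[OF module_axioms t.bilinear_bracket])
  have lie: "lie_algebra (fls_scale s) (fls_extend br_t)"
    by (rule lie_algebra_fls_extend[OF module_axioms t.lie_algebra_axioms])
  have m: "module (fls_scale s)" by (rule module_fls_scale[OF module_axioms t.module_axioms])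
  have lin: "Vector_Spaces.linear (fls_scale s) (*) (fls_map F)"
    by (rule linear_fls_map[OF F m])
  have "nondegenerate_form (\<lambda>X Y. fls_map F (fls_extend br_t X Y))"
  proof (rule nondegenerate_form_linear_bracketI[OF lie lin], rule ccontr)
    fix X assume z: "\<And>Y. fls_map F (fls_extend br_t X Y) = 0" and "X \<noteq> 0"
    define a x where "a = fls_subdegree X" and "x = fls_base_factor_to_fps X"
    have X: "X = laurent a x"
      unfolding a_def x_def by (rule fls_conv_base_factor_to_fps_shift_subdegree)
    have "fps_nth x 0 \<noteq> 0"
      unfolding x_def by (rule fls_base_factor_to_fps_base) fact
    then obtain y where y: "F (br (fps_nth x 0) y) \<noteq> 0"
      using nd unfolding nondegenerate_form_def by blast
    \<comment> \<open>The constant series has exponent 0, so degree \<open>a\<close> of the pairing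
      shows the constant term of the deformed bracket.\<close>
    have "fls_map F (fls_extend br_t X (laurent 0 (fps_const y))) $$ a
        = F (fps_nth (br_t x (fps_const y)) 0)"
      by (simp only: X \<beta>.fls_extend_laurent fls_map_nth F.zero) simp
    then show False
      using y z by (simp add: formal_deformation_nth_0[OF module_axioms d])
  qed
  then show ?thesis
    unfolding frobenius_lie_algebra_def
    using lie lin finite_dimensional_fls_scale[OF fd m] by blast
qed

theorem corollary2:
  fixes s :: "complex \<Rightarrow> 'v::ab_group_add \<Rightarrow> 'v"
    and bracket :: "'v \<Rightarrow> 'v \<Rightarrow> 'v"
  assumes "frobenius_lie_algebra s bracket"
  shows "(\<forall>bracket_t. formal_deformation s bracket bracket_t \<longrightarrow>
            frobenius_lie_algebra (fls_scale s) (fls_extend bracket_t)) \<and>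
         (\<forall>B. finite_dimensional_vector_space s B \<longrightarrow>
            (\<exists>U. openin (bilinear_map_topology s B) U \<and> bracket \<in> U \<and>
              (\<forall>bracket' \<in> U. lie_algebra s bracket' \<longrightarrow>
                 frobenius_lie_algebra s bracket')))"
  using frobenius_formal_deformation[OF assms] frobenius_lie_algebra_open[OF assms] by blast

end
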